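(* Let $X$ be a finite pure $(k+1)$-dimensional simplicial complex such that every $k$-simplex of $X$ is contained in exactly $D$ simplices of dimension $k+1$. If $D\ge 40^2(k+1)$ then $$h^k(X)\ \le\ \Big(1+\frac{50\sqrt{k+1}}{\sqrt{D}}\Big)\cdot\frac{D}{k+2}.$$
   Context: Cochains have $\mathbb{Z}_2$ coefficients; $\|\phi\|$ is the support size, $\|\phi\|_{csy}=\min_{\psi\in C^{k-1}(X)}\|\phi+d_{k-1}\psi\|$, and $h^k(X)=\min\{\|d_k\phi\|/\|\phi\|_{csy}:\phi\in C^k(X)\setminus B^k(X)\}$ with $B^k=d_{k-1}C^{k-1}$. *)

theory Defs
  imports Complex_Main "HOL-Library.Z2"
begin

text \<open>
  Abstract simplicial complexes contain the empty simplex, of dimension \<open>-1\<close>; hence dimensions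
  are integers, and the cochain complex below is the augmented one:
  \<open>C\<^sup>-\<^sup>1\<close> is one-dimensional and \<open>d\<^sub>-\<^sub>1\<close> sends its generator to the constant 0-cochain 1.
\<close>

definition simplicial_complex :: "'a set set \<Rightarrow> bool" where
  "simplicial_complex X \<longleftrightarrow>
     {} \<in> X \<and> (\<forall>\<sigma>\<in>X. finite \<sigma>) \<and> (\<forall>\<sigma>\<in>X. \<forall>\<tau>. \<tau> \<subseteq> \<sigma> \<longrightarrow> \<tau> \<in> X)"

definition simplex_dim :: "'a set \<Rightarrow> int" where
  "simplex_dim \<sigma> = int (card \<sigma>) - 1"

definition simplices :: "'a set set \<Rightarrow> int \<Rightarrow> 'a set set" where
  "simplices X i = {\<sigma> \<in> X. simplex_dim \<sigma> = i}"

definition complex_dim :: "'a set set \<Rightarrow> int" where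
  "complex_dim X = Max (simplex_dim ` X)"

definition pure_of_dim :: "'a set set \<Rightarrow> int \<Rightarrow> bool" where
  "pure_of_dim X n \<longleftrightarrow>
     complex_dim X = n \<and>
     (\<forall>\<sigma>\<in>X. (\<forall>\<tau>\<in>X. \<sigma> \<subseteq> \<tau> \<longrightarrow> \<tau> = \<sigma>) \<longrightarrow> simplex_dim \<sigma> = n)"

text \<open>
  Cochains are functions on all vertex sets that vanish off the simplices of the given dimension,
  so that equality of cochains is equality of functions.
\<close>

definition cochains :: "'a set set \<Rightarrow> int \<Rightarrow> ('a set \<Rightarrow> bit) set" where
  "cochains X i = {\<phi>. \<forall>\<sigma>. \<sigma> \<notin> simplices X i \<longrightarrow> \<phi> \<sigma> = 0}"

definition coboundary :: "'a set set \<Rightarrow> int \<Rightarrow> ('a set \<Rightarrow> bit) \<Rightarrow> 'a set \<Rightarrow> bit" where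
  "coboundary X i \<phi> \<tau> = (if \<tau> \<in> simplices X (i + 1) then \<Sum>v\<in>\<tau>. \<phi> (\<tau> - {v}) else 0)"

definition coboundaries :: "'a set set \<Rightarrow> int \<Rightarrow> ('a set \<Rightarrow> bit) set" where
  "coboundaries X i = coboundary X (i - 1) ` cochains X (i - 1)"

definition cochain_norm :: "('a set \<Rightarrow> bit) \<Rightarrow> nat" where
  "cochain_norm \<phi> = card {\<sigma>. \<phi> \<sigma> \<noteq> 0}"

definition cosystolic_norm :: "'a set set \<Rightarrow> int \<Rightarrow> ('a set \<Rightarrow> bit) \<Rightarrow> nat" where
  "cosystolic_norm X i \<phi> =
     Min {cochain_norm (\<lambda>\<sigma>. \<phi> \<sigma> + coboundary X (i - 1) \<psi> \<sigma>) | \<psi>. \<psi> \<in> cochains X (i - 1)}"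

definition coboundary_expansion :: "'a set set \<Rightarrow> int \<Rightarrow> real" where
  "coboundary_expansion X i =
     Min {real (cochain_norm (coboundary X i \<phi>)) / real (cosystolic_norm X i \<phi>) | \<phi>.
            \<phi> \<in> cochains X i - coboundaries X i}"

text \<open>The sets over which the minima above are taken are finite when the complex is.\<close>

lemma finite_cochains:
  assumes "finite X"
  shows "finite (cochains X i)"
proof -
  let ?f = "\<lambda>S \<sigma>. if \<sigma> \<in> S then (1::bit) else 0"
  have "cochains X i \<subseteq> ?f ` Pow (simplices X i)"
  proof
    fix \<phi> assume "\<phi> \<in> cochains X i"
    then have "{\<sigma>. \<phi> \<sigma> \<noteq> 0} \<subseteq> simplices X i"
      by (auto simp: cochains_def)
    moreover have "\<phi> = ?f {\<sigma>. \<phi> \<sigma> \<noteq> 0}"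
      by auto
    ultimately show "\<phi> \<in> ?f ` Pow (simplices X i)"
      by blast
  qed
  moreover have "finite (?f ` Pow (simplices X i))"
    using assms by (simp add: simplices_def)
  ultimately show ?thesis
    by (rule finite_subset)
qed

end

theory Submission
  imports Defs
begin

text \<open>
  Average over all \<open>k\<close>-cochains \<open>\<phi>\<close>. The coboundary of a uniformly random \<open>\<phi>\<close> takes each value
  with probability \<open>1/2\<close>, so \<open>\<parallel>d\<phi>\<parallel>\<close> has mean \<open>D n / (2 (k + 2))\<close>, where \<open>n\<close> is the number of
  \<open>k\<close>-simplices. Every \<open>(k-1)\<close>-simplex lies in at least \<open>D\<close> \<open>k\<close>-simplices, so there are at most
  \<open>2\<^sup>N\<close> coboundaries with \<open>N \<le> n (k + 1) / D\<close>; an exponential moment and a union bound then show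
  that \<open>\<parallel>\<phi>\<parallel>\<^sub>c\<^sub>s\<^sub>y\<close> has mean at least \<open>(n / 2) (1 - 3 s)\<close> with \<open>s = sqrt ((k + 1) / D)\<close>. Since
  \<open>h \<parallel>\<phi>\<parallel>\<^sub>c\<^sub>s\<^sub>y \<le> \<parallel>d\<phi>\<parallel>\<close> holds for every \<open>\<phi>\<close>, comparing the means bounds \<open>h\<close>.
\<close>

section \<open>Distribution of the support size of a random \<open>bit\<close>-valued
  function\<close>

definition supported_on :: "'b set \<Rightarrow> ('b \<Rightarrow> bit) set" where
  "supported_on S = {\<phi>. \<forall>x. x \<notin> S \<longrightarrow> \<phi> x = 0}"

lemma bij_betw_support:
  "bij_betw (\<lambda>\<phi>. {x. \<phi> x \<noteq> 0}) (supported_on S) (Pow S)"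
  by (rule bij_betw_byWitness[where f' = "\<lambda>A x. if x \<in> A then 1 else 0"])
    (auto simp: supported_on_def fun_eq_iff)

lemma finite_supported_on: "finite S \<Longrightarrow> finite (supported_on S)"
  using bij_betw_finite[OF bij_betw_support, of S] by simp

lemma card_supported_on: "finite S \<Longrightarrow> card (supported_on S) = 2 ^ card S"
  using bij_betw_same_card[OF bij_betw_support, of S] by (simp add: card_Pow)

text \<open>Each point of \<open>S\<close> independently contributes a factor \<open>q\<close> or
  \<open>1\<close>. For \<open>q = exp (- s)\<close> this is the exponential moment of a binomial
  variable, up to the factor \<open>2 ^ card S\<close>.\<close>

lemma sum_power_support:
  fixes q :: "'c::comm_semiring_1"
  assumes "finite S"
  shows "(\<Sum>\<phi>\<in>supported_on S. q ^ card {x. \<phi> x \<noteq> 0}) = (1 + q) ^ card S"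
proof -
  have "(\<Sum>\<phi>\<in>supported_on S. q ^ card {x. \<phi> x \<noteq> 0}) = (\<Sum>A\<in>Pow S. q ^ card A)"
    by (rule sum.reindex_bij_betw[OF bij_betw_support])
  also have "\<dots> = (\<Prod>x\<in>S. q + 1)"
    using prod_add[OF assms, of "\<lambda>_. q" "\<lambda>_. 1"] by simp
  finally show ?thesis by (simp add: add.commute)
qed

lemma bij_betw_translate:
  assumes "b \<in> supported_on S"
  shows "bij_betw (\<lambda>\<phi> x. \<phi> x + b x) (supported_on S) (supported_on S)"
  using assms
  by (intro bij_betw_byWitness[where f' = "\<lambda>\<phi> x. \<phi> x + b x"])
    (auto simp: supported_on_def fun_eq_iff add.assoc)

text \<open>Adding \<open>b\<close> permutes \<open>supported_on S\<close>, so the distance to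
  \<open>b\<close> is distributed like the distance to 0.\<close>

lemma sum_power_support_translate:
  fixes q :: "'c::comm_semiring_1"
  assumes "finite S" "b \<in> supported_on S"
  shows "(\<Sum>\<phi>\<in>supported_on S. q ^ card {x. \<phi> x + b x \<noteq> 0}) = (1 + q) ^ card S"
  using sum.reindex_bij_betw[OF bij_betw_translate[OF assms(2)],
      of "\<lambda>\<phi>. q ^ card {x. \<phi> x \<noteq> 0}"] sum_power_support[OF assms(1), of q]
  by simp

section \<open>Mean distance to a small family, by an exponential moment\<close>

lemma one_plus_exp_minus_le:
  fixes s :: real
  assumes "0 \<le> s"
  shows "1 + exp (- s) \<le> 2 * exp (- s / 2 + s\<^sup>2 / 2)"
proof -
  \<comment> \<open>The product equals \<open>1 + s ^ 3\<close>.\<close>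
  have "1 \<le> (1 + s) * (1 - s + s\<^sup>2)"
    using assms by (simp add: algebra_simps power2_eq_square)
  also have "\<dots> \<le> exp s * (1 - s + s\<^sup>2)"
  proof (rule mult_right_mono)
    have "0 \<le> (1 - s / 2)\<^sup>2 + 3 / 4 * s\<^sup>2" by simp
    then show "0 \<le> 1 - s + s\<^sup>2" by (simp add: power2_eq_square algebra_simps)
  qed simp
  finally have "exp (- s) \<le> 1 - s + s\<^sup>2"
    by (simp add: exp_minus field_simps)
  moreover have "1 + (- s / 2 + s\<^sup>2 / 2) \<le> exp (- s / 2 + s\<^sup>2 / 2)"
    by (rule exp_ge_add_one_self)
  ultimately show ?thesis by argo
qed

text \<open>The term of the attaining index is one summand of the sum over \<open>I\<close>, so
  \<open>exp (- s) ^ m \<phi>\<close> costs only a factor \<open>card I\<close> on average.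
  Convexity of \<open>exp\<close> turns this into a bound on the mean, without tail
  estimates.\<close>

lemma mean_distance_to_family:
  fixes b :: "'i \<Rightarrow> 'b \<Rightarrow> bit" and m :: "('b \<Rightarrow> bit) \<Rightarrow> nat" and s :: real
  assumes "finite S" "finite I" "0 < s"
    and b: "\<And>i. i \<in> I \<Longrightarrow> b i \<in> supported_on S"
    and I: "real (card I) \<le> exp (s\<^sup>2 * card S)"
    and m: "\<And>\<phi>. \<phi> \<in> supported_on S \<Longrightarrow> \<exists>i\<in>I. m \<phi> = card {x. \<phi> x + b i x \<noteq> 0}"
  shows "2 ^ card S * (card S / 2 * (1 - 3 * s)) \<le> (\<Sum>\<phi>\<in>supported_on S. real (m \<phi>))"
proof -
  let ?V = "supported_on S" and ?n = "card S"
  \<comment> \<open>Chosen so that \<open>- s * c\<close> collects the whole exponent: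
    \<open>- s / 2\<close> per point from the mean, \<open>s\<^sup>2 / 2\<close> from the moment
    bound and \<open>s\<^sup>2\<close> from \<open>card I\<close>.\<close>
  define c where "c = ?n / 2 * (1 - 3 * s)"
  have fV: "finite ?V" and cV: "real (card ?V) = 2 ^ ?n"
    using finite_supported_on card_supported_on assms(1) by auto
  have "(\<Sum>\<phi>\<in>?V. exp (- s) ^ m \<phi>)
      \<le> (\<Sum>\<phi>\<in>?V. \<Sum>i\<in>I. exp (- s) ^ card {x. \<phi> x + b i x \<noteq> 0})"
  proof (rule sum_mono)
    fix \<phi> assume "\<phi> \<in> ?V"
    then obtain i where "i \<in> I" "m \<phi> = card {x. \<phi> x + b i x \<noteq> 0}" using m by blast
    then show "exp (- s) ^ m \<phi> \<le> (\<Sum>i\<in>I. exp (- s) ^ card {x. \<phi> x + b i x \<noteq> 0})"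
      using member_le_sum[of i I "\<lambda>i. exp (- s) ^ card {x. \<phi> x + b i x \<noteq> 0}"] assms(2)
      by simp
  qed
  also have "\<dots> = (\<Sum>i\<in>I. \<Sum>\<phi>\<in>?V. exp (- s) ^ card {x. \<phi> x + b i x \<noteq> 0})"
    by (rule sum.swap)
  also have "\<dots> = (\<Sum>i\<in>I. (1 + exp (- s)) ^ ?n)"
    using sum_power_support_translate[OF assms(1) b] by (intro sum.cong) auto
  also have "\<dots> = card I * (1 + exp (- s)) ^ ?n"
    by simp
  also have "\<dots> \<le> exp (s\<^sup>2 * ?n) * (2 * exp (- s / 2 + s\<^sup>2 / 2)) ^ ?n"
    using I one_plus_exp_minus_le[of s] assms(3)
    by (intro mult_mono power_mono) (auto intro: add_nonneg_nonneg)
  also have "\<dots> = 2 ^ ?n * exp (s\<^sup>2 * ?n + ?n * (- s / 2 + s\<^sup>2 / 2))"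
    by (simp only: power_mult_distrib exp_of_nat_mult exp_add mult_ac)
  also have "s\<^sup>2 * ?n + ?n * (- s / 2 + s\<^sup>2 / 2) = - s * c"
    by (simp add: c_def field_simps power2_eq_square)
  finally have E: "(\<Sum>\<phi>\<in>?V. exp (- s) ^ m \<phi>) \<le> 2 ^ ?n * exp (- s * c)" .
  \<comment> \<open>Jensen's inequality in pointwise form: the tangent to \<open>exp\<close> at 0,
    reached when \<open>m \<phi> = c\<close>. Summed over \<phi>, the correction term is nonnegative
    by \<open>E\<close>.\<close>
  have tangent: "c + (1 - exp (s * c) * exp (- s) ^ m \<phi>) / s \<le> m \<phi>" for \<phi>
  proof -
    have "1 + s * (c - m \<phi>) \<le> exp (s * (c - m \<phi>))"
      by (rule exp_ge_add_one_self)
    also have "\<dots> = exp (s * c) * exp (- s) ^ m \<phi>"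
      by (simp add: right_diff_distrib exp_diff exp_minus exp_of_nat2_mult power_inverse
          divide_inverse)
    finally show ?thesis using assms(3) by (simp add: field_simps)
  qed
  have "exp (s * c) * (\<Sum>\<phi>\<in>?V. exp (- s) ^ m \<phi>) \<le> exp (s * c) * (2 ^ ?n * exp (- s * c))"
    using E by (intro mult_left_mono) auto
  also have "\<dots> = 2 ^ ?n"
    by (simp add: exp_minus)
  finally have "2 ^ ?n * c
      \<le> 2 ^ ?n * c + (2 ^ ?n - exp (s * c) * (\<Sum>\<phi>\<in>?V. exp (- s) ^ m \<phi>)) / s"
    using assms(3) by simp
  also have "\<dots> = (\<Sum>\<phi>\<in>?V. c + (1 - exp (s * c) * exp (- s) ^ m \<phi>) / s)"
    by (simp add: sum.distrib sum_subtractf cV flip: sum_divide_distrib sum_distrib_left)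
  also have "\<dots> \<le> (\<Sum>\<phi>\<in>?V. real (m \<phi>))"
    by (intro sum_mono tangent)
  finally show ?thesis unfolding c_def .
qed

section \<open>Incidence counts and the mean norm of a coboundary\<close>

lemma cochains_eq: "cochains X i = supported_on (simplices X i)"
  by (simp add: cochains_def supported_on_def)

text \<open>Cardinalities treat \<open>k = 0\<close> uniformly: there the last set consists of the
  empty simplex.\<close>

lemma simplices_eq:
  "simplices X (int k) = {\<sigma> \<in> X. card \<sigma> = k + 1}"
  "simplices X (int k + 1) = {\<sigma> \<in> X. card \<sigma> = k + 2}"
  "simplices X (int k - 1) = {\<sigma> \<in> X. card \<sigma> = k}"
  by (auto simp: simplices_def simplex_dim_def)

lemma coboundary_in_cochains: "coboundary X (i - 1) \<psi> \<in> cochains X i"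
  by (simp add: coboundary_def cochains_def)

lemma sum_card_incident_swap:
  assumes "finite A" "finite B"
  shows "(\<Sum>a\<in>A. card {b \<in> B. R a b}) = (\<Sum>b\<in>B. card {a \<in> A. R a b})"
proof -
  have "(\<Sum>a\<in>A. card {b \<in> B. R a b}) = (\<Sum>a\<in>A. \<Sum>b\<in>B. if R a b then 1 else 0)"
    using assms by (simp add: sum.If_cases Int_def)
  also have "\<dots> = (\<Sum>b\<in>B. \<Sum>a\<in>A. if R a b then 1 else 0)"
    by (rule sum.swap)
  finally show ?thesis
    using assms by (simp add: sum.If_cases Int_def)
qed

lemma card_facets:
  assumes "simplicial_complex X" "\<tau> \<in> X" "card \<tau> = j + 1"
  shows "card {\<sigma> \<in> X. card \<sigma> = j \<and> \<sigma> \<subseteq> \<tau>} = j + 1"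
proof -
  have "finite \<tau>" using assms by (auto simp: simplicial_complex_def)
  moreover have "{\<sigma> \<in> X. card \<sigma> = j \<and> \<sigma> \<subseteq> \<tau>} = {\<sigma>. \<sigma> \<subseteq> \<tau> \<and> card \<sigma> = j}"
    using assms by (auto simp: simplicial_complex_def)
  ultimately show ?thesis using n_subsets[of \<tau> j] assms(3) by simp
qed

text \<open>Toggling \<open>\<phi>\<close> on one facet of \<open>\<tau>\<close> flips the value of the coboundary at \<open>\<tau>\<close>.\<close>

lemma card_coboundary_nonzero:
  assumes "simplicial_complex X" "finite X" and \<tau>: "\<tau> \<in> simplices X (int k + 1)"
  shows "2 * card {\<phi> \<in> cochains X (int k). coboundary X (int k) \<phi> \<tau> \<noteq> 0}
    = card (cochains X (int k))"
proof -
  let ?C = "cochains X (int k)" and ?d = "\<lambda>\<phi>. coboundary X (int k) \<phi> \<tau>"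
  have t: "\<tau> \<in> X" "card \<tau> = k + 2" "finite \<tau>"
    using \<tau> assms by (auto simp: simplices_eq simplicial_complex_def)
  then obtain u where u: "u \<in> \<tau>" by fastforce
  define e :: "'a set \<Rightarrow> bit" where "e = (\<lambda>\<sigma>. if \<sigma> = \<tau> - {u} then 1 else 0)"
  have "\<tau> - {u} \<in> simplices X (int k)"
    using t u assms(1) by (auto simp: simplices_eq simplicial_complex_def)
  then have eC: "e \<in> ?C" by (auto simp: e_def cochains_def)
  \<comment> \<open>Different vertices have different opposite facets.\<close>
  have "(\<Sum>v\<in>\<tau>. e (\<tau> - {v})) = (\<Sum>v\<in>\<tau>. if v = u then 1 else 0)"
    using u by (intro sum.cong) (auto simp: e_def)
  also have "\<dots> = 1" using u t by simp
  finally have e1: "(\<Sum>v\<in>\<tau>. e (\<tau> - {v})) = 1" .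
  define f where "f = (\<lambda>\<phi> \<sigma>. \<phi> \<sigma> + e \<sigma>)"
  have flip: "?d (f \<phi>) = ?d \<phi> + 1" for \<phi>
    using \<tau> by (simp only: f_def coboundary_def sum.distrib if_True e1)
  have mem: "f \<phi> \<in> ?C" if "\<phi> \<in> ?C" for \<phi>
    using that eC by (auto simp: f_def cochains_def)
  have inv: "f (f \<phi>) = \<phi>" for \<phi>
    by (auto simp: f_def fun_eq_iff)
  have "bij_betw f {\<phi> \<in> ?C. ?d \<phi> \<noteq> 0} {\<phi> \<in> ?C. ?d \<phi> = 0}"
    by (rule bij_betw_byWitness[where f' = f]) (auto simp: flip mem inv)
  then have "card {\<phi> \<in> ?C. ?d \<phi> \<noteq> 0} = card {\<phi> \<in> ?C. ?d \<phi> = 0}"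
    by (rule bij_betw_same_card)
  moreover have "card ?C = card {\<phi> \<in> ?C. ?d \<phi> \<noteq> 0} + card {\<phi> \<in> ?C. ?d \<phi> = 0}"
    using finite_cochains[OF assms(2)]
    by (subst card_Un_disjoint[symmetric]) (auto intro: arg_cong[where f = card])
  ultimately show ?thesis by simp
qed

text \<open>Linearity of expectation: by double counting, each top simplex is charged for exactly
  half of the cochains.\<close>

lemma sum_norm_coboundary:
  assumes "simplicial_complex X" "finite X"
  shows "2 * (\<Sum>\<phi>\<in>cochains X (int k). cochain_norm (coboundary X (int k) \<phi>))
    = card (simplices X (int k + 1)) * card (cochains X (int k))"
proof -
  let ?C = "cochains X (int k)" and ?T = "simplices X (int k + 1)"
  have fT: "finite ?T" using assms by (simp add: simplices_def)
  have "cochain_norm (coboundary X (int k) \<phi>) = card {\<tau> \<in> ?T. coboundary X (int k) \<phi> \<tau> \<noteq> 0}"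
    for \<phi>
    unfolding cochain_norm_def by (rule arg_cong[where f = card]) (auto simp: coboundary_def)
  then have "(\<Sum>\<phi>\<in>?C. cochain_norm (coboundary X (int k) \<phi>))
      = (\<Sum>\<tau>\<in>?T. card {\<phi> \<in> ?C. coboundary X (int k) \<phi> \<tau> \<noteq> 0})"
    using sum_card_incident_swap[OF finite_cochains[OF assms(2), of "int k"] fT] by simp
  then show ?thesis
    using card_coboundary_nonzero[OF assms] by (simp add: sum_distrib_left)
qed

section \<open>The cosystolic norm and its inequality with the expansion constant\<close>

lemma cosystolic_norm_cases:
  assumes "finite X"
  obtains \<psi> where "\<psi> \<in> cochains X (i - 1)"
    "cosystolic_norm X i \<phi> = card {\<sigma>. \<phi> \<sigma> + coboundary X (i - 1) \<psi> \<sigma> \<noteq> 0}"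
proof -
  let ?A = "{cochain_norm (\<lambda>\<sigma>. \<phi> \<sigma> + coboundary X (i - 1) \<psi> \<sigma>) | \<psi>. \<psi> \<in> cochains X (i - 1)}"
  have "finite ?A" using finite_cochains[OF assms, of "i - 1"] by simp
  moreover have "(\<lambda>_. 0) \<in> cochains X (i - 1)" by (simp add: cochains_def)
  then have "?A \<noteq> {}" by blast
  ultimately have "Min ?A \<in> ?A" by (rule Min_in)
  then show thesis
    unfolding cosystolic_norm_def[symmetric] using that by (auto simp: cochain_norm_def)
qed

lemma cosystolic_norm_coboundary:
  assumes "finite X" "\<phi> \<in> coboundaries X i"
  shows "cosystolic_norm X i \<phi> = 0"
proof -
  let ?A = "{cochain_norm (\<lambda>\<sigma>. \<phi> \<sigma> + coboundary X (i - 1) \<psi> \<sigma>) | \<psi>. \<psi> \<in> cochains X (i - 1)}"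
  obtain \<psi> where \<psi>: "\<psi> \<in> cochains X (i - 1)" "\<phi> = coboundary X (i - 1) \<psi>"
    using assms(2) by (auto simp: coboundaries_def)
  have "finite ?A" using finite_cochains[OF assms(1), of "i - 1"] by simp
  moreover have "cochain_norm (\<lambda>\<sigma>. \<phi> \<sigma> + coboundary X (i - 1) \<psi> \<sigma>) = 0"
    using \<psi>(2) by (simp add: cochain_norm_def)
  then have "0 \<in> ?A" using \<psi>(1) by force
  ultimately have "Min ?A \<le> 0" by (rule Min_le)
  then show ?thesis by (simp add: cosystolic_norm_def)
qed

text \<open>Coboundaries, which the minimum excludes, have cosystolic norm 0 and satisfy the product
  form trivially. Hence it can be averaged over all cochains.\<close>

lemma coboundary_expansion_mult_le:
  assumes "finite X" "\<phi> \<in> cochains X i"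
  shows "coboundary_expansion X i * cosystolic_norm X i \<phi> \<le> cochain_norm (coboundary X i \<phi>)"
proof (cases "cosystolic_norm X i \<phi> = 0")
  case False
  let ?A = "{real (cochain_norm (coboundary X i \<phi>)) / real (cosystolic_norm X i \<phi>) | \<phi>.
            \<phi> \<in> cochains X i - coboundaries X i}"
  have "finite ?A" using finite_cochains[OF assms(1), of i] by simp
  moreover have "\<phi> \<notin> coboundaries X i"
    using False cosystolic_norm_coboundary[OF assms(1), of \<phi> i] by auto
  then have "real (cochain_norm (coboundary X i \<phi>)) / real (cosystolic_norm X i \<phi>) \<in> ?A"
    using assms(2) by blast
  ultimately have "coboundary_expansion X i
      \<le> real (cochain_norm (coboundary X i \<phi>)) / real (cosystolic_norm X i \<phi>)"
    unfolding coboundary_expansion_def by (rule Min_le)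
  then show ?thesis using False by (simp add: field_simps)
qed simp

section \<open>Degrees in a pure complex\<close>

lemma pure_extend:
  assumes "simplicial_complex X" "finite X" "pure_of_dim X n" "\<sigma> \<in> X"
  obtains \<rho> where "\<rho> \<in> X" "\<sigma> \<subseteq> \<rho>" "simplex_dim \<rho> = n"
proof -
  obtain \<rho> where \<rho>: "\<rho> \<in> X" "\<sigma> \<subseteq> \<rho>" "\<forall>\<tau>\<in>X. \<rho> \<subseteq> \<tau> \<longrightarrow> \<rho> = \<tau>"
    using finite_has_maximal2[OF assms(2,4)] by blast
  then have "simplex_dim \<rho> = n" using assms(3) unfolding pure_of_dim_def by metis
  with \<rho> show thesis using that by blast
qed

text \<open>
  If \<open>\<sigma> \<union> {u}\<close> is a \<open>k\<close>-simplex, then removing \<open>u\<close> from the \<open>D\<close> simplices of dimension \<open>k + 1\<close>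
  that contain it gives \<open>D\<close> different \<open>k\<close>-simplices containing \<open>\<sigma>\<close>.
\<close>

lemma degree_codim2_ge:
  assumes "simplicial_complex X" "finite X" "pure_of_dim X (int k + 1)"
    and "\<And>\<sigma>. \<sigma> \<in> simplices X (int k) \<Longrightarrow> card {\<tau> \<in> simplices X (int k + 1). \<sigma> \<subseteq> \<tau>} = D"
    and \<sigma>: "\<sigma> \<in> X" "card \<sigma> = k"
  shows "D \<le> card {\<tau> \<in> simplices X (int k). \<sigma> \<subseteq> \<tau>}"
proof -
  obtain \<rho> where \<rho>: "\<rho> \<in> X" "\<sigma> \<subseteq> \<rho>" "simplex_dim \<rho> = int k + 1"
    using pure_extend[OF assms(1-3) \<sigma>(1)] by blast
  then have "card \<rho> \<noteq> card \<sigma>" using \<sigma> by (simp add: simplex_dim_def)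
  then obtain u where u: "u \<in> \<rho>" "u \<notin> \<sigma>" using \<rho>(2) by (metis subsetI subset_antisym)
  have fin: "finite \<tau>" if "\<tau> \<in> X" for \<tau>
    using assms(1) that by (simp add: simplicial_complex_def)
  have down: "\<tau>' \<in> X" if "\<tau> \<in> X" "\<tau>' \<subseteq> \<tau>" for \<tau> \<tau>'
    using assms(1) that by (auto simp: simplicial_complex_def)
  have "insert u \<sigma> \<in> simplices X (int k)"
    using u \<rho> \<sigma> fin[OF \<sigma>(1)] down[OF \<rho>(1), of "insert u \<sigma>"] by (simp add: simplices_eq)
  then have "D = card {\<tau> \<in> simplices X (int k + 1). insert u \<sigma> \<subseteq> \<tau>}"
    using assms(4)[of "insert u \<sigma>"] by simp
  also have "\<dots> \<le> card {\<tau> \<in> simplices X (int k). \<sigma> \<subseteq> \<tau>}"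
  proof (rule card_inj_on_le)
    show "inj_on (\<lambda>\<tau>. \<tau> - {u}) {\<tau> \<in> simplices X (int k + 1). insert u \<sigma> \<subseteq> \<tau>}"
      by (auto simp: inj_on_def)
    show "(\<lambda>\<tau>. \<tau> - {u}) ` {\<tau> \<in> simplices X (int k + 1). insert u \<sigma> \<subseteq> \<tau>}
        \<subseteq> {\<tau> \<in> simplices X (int k). \<sigma> \<subseteq> \<tau>}"
      using u fin by (auto simp: simplices_eq intro: down)
    show "finite {\<tau> \<in> simplices X (int k). \<sigma> \<subseteq> \<tau>}"
      using assms(2) by (simp add: simplices_def)
  qed
  finally show ?thesis .
qed

section \<open>Comparison of the two means\<close>

theorem theorem5p3:
  fixes X :: "'a set set" and k D :: nat
  assumes "simplicial_complex X" and "finite X"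
    and "pure_of_dim X (int k + 1)"
    and "\<And>\<sigma>. \<sigma> \<in> simplices X (int k) \<Longrightarrow> card {\<tau> \<in> simplices X (int k + 1). \<sigma> \<subseteq> \<tau>} = D"
    and "D \<ge> 40\<^sup>2 * (k + 1)"
  shows "coboundary_expansion X (int k)
           \<le> (1 + 50 * sqrt (real (k + 1)) / sqrt (real D)) * (real D / real (k + 2))"
proof -
  let ?K = "simplices X (int k)" and ?T = "simplices X (int k + 1)"
    and ?J = "simplices X (int k - 1)" and ?C = "cochains X (int k)"
  define s where "s = sqrt (real (k + 1)) / sqrt (real D)"
  let ?n = "card ?K" and ?h = "coboundary_expansion X (int k)"
  let ?csy = "\<Sum>\<phi>\<in>?C. real (cosystolic_norm X (int k) \<phi>)"
  have fin: "finite ?K" "finite ?T" "finite ?J" using assms(2) by (auto simp: simplices_def)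
  have "1600 * (k + 1) \<le> D" using assms(5) by simp
  then have "real (1600 * (k + 1)) \<le> real D" by (simp only: of_nat_le_iff)
  then have D: "1600 * real (k + 1) \<le> real D" by simp
  have D0: "real D > 0" using assms(5) by simp
  have s0: "0 < s" using D0 by (simp add: s_def)
  have s2: "s\<^sup>2 = real (k + 1) / real D" by (simp add: s_def power_divide)
  have "s\<^sup>2 \<le> (1 / 40)\<^sup>2" using D D0 unfolding s2 by (simp add: field_simps)
  then have s40: "s \<le> 1 / 40" by (rule power2_le_imp_le) simp

  \<comment> \<open>Extending the empty simplex yields a top simplex, so \<open>?n\<close> is
    positive and can be cancelled at the end.\<close>
  have "{} \<in> X" using assms(1) by (simp add: simplicial_complex_def)
  from pure_extend[OF assms(1-3) this] obtain \<rho> where \<rho>: "\<rho> \<in> ?T"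
    unfolding simplices_def by blast
  have "card {\<sigma> \<in> X. card \<sigma> = k + 1 \<and> \<sigma> \<subseteq> \<rho>} = k + 2"
    using card_facets[OF assms(1), of \<rho> "k + 1"] \<rho> by (simp add: simplices_eq)
  then have "{\<sigma> \<in> X. card \<sigma> = k + 1 \<and> \<sigma> \<subseteq> \<rho>} \<noteq> {}"
    by (metis card.empty add_2_eq_Suc' nat.distinct(1))
  then have "?K \<noteq> {}" by (auto simp: simplices_eq)
  then have n0: "?n > 0" using fin by (simp add: card_gt_0_iff)

  have "(\<Sum>\<sigma>\<in>?K. card {\<tau> \<in> ?T. \<sigma> \<subseteq> \<tau>}) = (\<Sum>\<tau>\<in>?T. card {\<sigma> \<in> ?K. \<sigma> \<subseteq> \<tau>})"
    by (rule sum_card_incident_swap[OF fin(1,2)])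
  moreover have "card {\<sigma> \<in> ?K. \<sigma> \<subseteq> \<tau>} = k + 2" if "\<tau> \<in> ?T" for \<tau>
    using card_facets[OF assms(1), of \<tau> "k + 1"] that by (simp add: simplices_eq)
  ultimately have "?n * D = card ?T * (k + 2)" using assms(4) by simp
  then have "real ?n * real D = real (card ?T) * real (k + 2)" by (metis of_nat_mult)
  then have nT: "real (card ?T) = real ?n * (real D / real (k + 2))"
    by (simp add: eq_divide_eq del: of_nat_add)

  \<comment> \<open>Counting incidences between dimensions \<open>k - 1\<close> and \<open>k\<close>
    bounds the number of bits that determine a coboundary.\<close>
  have "card ?J * D \<le> (\<Sum>\<sigma>\<in>?J. card {\<tau> \<in> ?K. \<sigma> \<subseteq> \<tau>})"
    using sum_bounded_below[of ?J D "\<lambda>\<sigma>. card {\<tau> \<in> ?K. \<sigma> \<subseteq> \<tau>}"]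
      degree_codim2_ge[OF assms(1-4)] by (simp add: simplices_eq)
  also have "\<dots> = (\<Sum>\<tau>\<in>?K. card {\<sigma> \<in> ?J. \<sigma> \<subseteq> \<tau>})"
    by (rule sum_card_incident_swap[OF fin(3,1)])
  also have "\<dots> = (\<Sum>\<tau>\<in>?K. k + 1)"
    using card_facets[OF assms(1)] by (intro sum.cong) (auto simp: simplices_eq)
  finally have "card ?J * D \<le> ?n * (k + 1)" by simp
  then have "real (card ?J) * D \<le> real ?n * (k + 1)" by (metis of_nat_le_iff of_nat_mult)
  then have J: "real (card ?J) \<le> s\<^sup>2 * ?n"
    unfolding s2 using D0 by (simp add: field_simps)
  \<comment> \<open>The family is indexed by cochains \<psi> instead of their coboundaries;
    repetitions are harmless for a union bound.\<close>
  have "real (card (cochains X (int k - 1))) = 2 ^ card ?J"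
    by (simp add: cochains_eq card_supported_on fin)
  also have "\<dots> \<le> exp 1 ^ card ?J"
    using exp_ge_add_one_self[of 1] by (intro power_mono) auto
  also have "\<dots> \<le> exp (s\<^sup>2 * ?n)"
    using J by (simp flip: exp_of_nat_mult)
  finally have "real (card (cochains X (int k - 1))) \<le> exp (s\<^sup>2 * ?n)" .
  then have csy: "2 ^ ?n * (?n / 2 * (1 - 3 * s)) \<le> ?csy"
    unfolding cochains_eq[of X "int k"]
    using finite_cochains[OF assms(2), of "int k - 1"] fin(1) s0
  proof (intro mean_distance_to_family[where I = "cochains X (int k - 1)"
          and b = "coboundary X (int k - 1)"])
    show "coboundary X (int k - 1) \<psi> \<in> supported_on ?K" for \<psi>
      using coboundary_in_cochains unfolding cochains_eq .
    show "\<exists>\<psi>\<in>cochains X (int k - 1). cosystolic_norm X (int k) \<phi>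
        = card {\<sigma>. \<phi> \<sigma> + coboundary X (int k - 1) \<psi> \<sigma> \<noteq> 0}" for \<phi>
      by (rule cosystolic_norm_cases[OF assms(2), of "int k" \<phi>]) blast
  qed

  have bound_nonneg: "0 \<le> (1 + 50 * s) * (real D / real (k + 2))"
    using s0 by simp
  have "?h \<le> (1 + 50 * s) * (real D / real (k + 2))"
  \<comment> \<open>Scaling \<open>csy\<close> by \<open>?h\<close> needs a sign. The split avoids
    showing that the set under \<open>Min\<close> is nonempty.\<close>
  proof (cases "?h \<le> 0")
    case True
    then show ?thesis using bound_nonneg by linarith
  next
    case False
    have "(2 ^ ?n * real ?n) * (?h * (1 - 3 * s)) = 2 * (?h * (2 ^ ?n * (?n / 2 * (1 - 3 * s))))"
      by simp
    also have "\<dots> \<le> 2 * (?h * ?csy)"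
      using False csy by (intro mult_left_mono) auto
    also have "\<dots> \<le> 2 * (\<Sum>\<phi>\<in>?C. real (cochain_norm (coboundary X (int k) \<phi>)))"
      unfolding sum_distrib_left[of ?h]
      by (intro mult_left_mono sum_mono coboundary_expansion_mult_le[OF assms(2)]) auto
    also have "\<dots> = real (card ?T) * real (card ?C)"
      using arg_cong[OF sum_norm_coboundary[OF assms(1,2), of k], of real] by simp
    also have "\<dots> = (2 ^ ?n * real ?n) * (real D / real (k + 2))"
      by (simp add: nT cochains_eq card_supported_on fin)
    finally have "(2 ^ ?n * real ?n) * (?h * (1 - 3 * s))
        \<le> (2 ^ ?n * real ?n) * (real D / real (k + 2))" .
    then have main: "?h * (1 - 3 * s) \<le> real D / real (k + 2)"
      by (rule mult_left_le_imp_le) (use n0 in simp)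
    \<comment> \<open>The product below is \<open>1 + 47 * s - 150 * s\<^sup>2\<close>, and
      \<open>s \<le> 1 / 40\<close> makes the quadratic term at most
      \<open>3.75 * s\<close>.\<close>
    have "150 * (s * s) \<le> 150 * (s * (1 / 40))"
      using s0 s40 by (intro mult_left_mono) auto
    then have "1 \<le> (1 + 50 * s) * (1 - 3 * s)"
      using s0 by (simp add: algebra_simps)
    then have "?h * 1 \<le> ?h * ((1 + 50 * s) * (1 - 3 * s))"
      using False by (intro mult_left_mono) auto
    also have "\<dots> = (1 + 50 * s) * (?h * (1 - 3 * s))"
      by (simp add: algebra_simps)
    also have "\<dots> \<le> (1 + 50 * s) * (real D / real (k + 2))"
      using main s0 by (intro mult_left_mono) auto
    finally show ?thesis by simp
  qed
  then show ?thesis by (simp only: s_def times_divide_eq_right)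
qed

end
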